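(* Let $P$ be an $R$-labeled poset of rank $n$ with fixed $R$-labeling $\lambda$. Then \[ {\text{ex}}\Psi(P;y,\mathbf{a},\mathbf{b}) = \sum_{(\mathcal{M},E)} y^{\#E}\cdot \mathsf{u}(\mathcal{M},E), \] where the sum ranges over all maximal chains $\mathcal{M}$ in $P$ and all subsets $E\subseteq\{1,\dots,n\}$.
   Context: A graded poset $P$ of rank $n$ is a finite poset with unique minimum $\hat 0$ (rank $0$) and unique maximum $\hat 1$ (rank $n$) such that ${\sf rank}(X)$ equals the length of every maximal chain from $\hat 0$ to $X$. A chain is a (possibly empty) totally ordered subset; for a chain $\mathcal{C}=\{\mathcal{C}_1<\dots<\mathcal{C}_k\}$ put ${\sf Rank}(\mathcal{C})=\{{\sf rank}(\mathcal{C}_i)\}$. For a graded poset $Q$ with minimum $\hat 0_Q$ and Möbius function $\mu$, its Poincaré polynomial is $\mathrm{Poin}(Q;y)=\sum_{X\in Q}|\mu(\hat 0_Q,X)|\,y^{{\sf rank}_Q(X)}$ (applied to intervals $[X,Y]$ with rank measured from $X$). The chain Poincaré polynomial of a chain $\mathcal{C}$ in $P$ is $\mathrm{Poin}_{\mathcal{C}}(P;y)=\prod_{i=1}^k\mathrm{Poin}([\mathcal{C}_i,\mathcal{C}_{i+1}];y)$ with $\mathcal{C}_{k+1}=\hat 1$ (empty product $=1$). The extended $\mathbf{a}\mathbf{b}$-index is ${\text{ex}}\Psi(P;y,\mathbf{a},\mathbf{b})=\sum_{\mathcal{C}}\mathrm{Poin}_{\mathcal{C}}(P;y)\,{\sf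 wt}_{\mathcal{C}}(\mathbf{a},\mathbf{b})\in\mathbb{Z}[y]\langle\mathbf{a},\mathbf{b}\rangle$, the sum over all chains $\mathcal{C}$ in $P\setminus\{\hat 1\}$, where $\mathbf{a},\mathbf{b}$ are noncommuting variables and ${\sf wt}_{\mathcal{C}}=w_0\cdots w_{n-1}$ with $w_i=\mathbf{b}$ if $i\in{\sf Rank}(\mathcal{C})$ and $w_i=\mathbf{a}-\mathbf{b}$ otherwise. An $R$-labeling of $P$ is a map $\lambda$ from cover relations $X\lessdot Y$ to positive integers such that every interval $[X,Y]$ has a unique maximal chain $X=\mathcal{M}_i\lessdot\dots\lessdot\mathcal{M}_j=Y$ with weakly increasing labels; $P$ is $R$-labeled if it is finite, graded and admits one. For a maximal chain $\mathcal{M}=\{\mathcal{M}_0\lessdot\dots\lessdot\mathcal{M}_n\}$, let $\mathsf{u}(\mathcal{M})=u_1\cdots u_n$ with $u_1=\mathbf{a}$ and, for $2\le i\le n$, $u_i=\mathbf{a}$ if $\lambda(\mathcal{M}_{i-2},\mathcal{M}_{i-1})\le\lambda(\mathcal{M}_{i-1},\mathcal{M}_i)$ and $u_i=\mathbf{b}$ otherwise. For $E\subseteq\{1,\dots,n\}$, let $\mathsf{u}(\mathcal{M},E)=v_1\cdots v_n$ where $v_i=\mathbf{a}$ if ($u_i=\mathbf{a}$ and $i\notin E$) or ($u_i=\mathbf{b}$ and $i-1\in E$), and $v_i=\mathbf{b}$ if ($u_i=\mathbf{a}$ and $i\in E$) or ($u_i=\mathbf{b}$ and $i-1\notin E$).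 *)

theory Defs
  imports
    Main
    "HOL-Library.Poly_Mapping"
    "HOL-Computational_Algebra.Polynomial"
begin

section \<open>The ring of noncommutative polynomials in two variables over \<open>\<int>[y]\<close>\<close>

datatype letter = A | B

text \<open>
  The free monoid on \<open>A, B\<close>, written additively because the convolution product on
  \<^typ>\<open>'k \<Rightarrow>\<^sub>0 'c\<close> is defined for exponents of class \<^class>\<open>monoid_add\<close>.
\<close>

datatype ab_word = Word "letter list"

instantiation ab_word :: monoid_add
begin

definition zero_ab_word :: ab_word
  where "0 = Word []"

fun plus_ab_word :: "ab_word \<Rightarrow> ab_word \<Rightarrow> ab_word"
  where "Word u + Word v = Word (u @ v)"

instance
proof
  fix u v w :: ab_word
  show "u + v + w = u + (v + w)"
    by (cases u; cases v; cases w) simp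
  show "0 + u = u" "u + 0 = u"
    by (cases u; simp add: zero_ab_word_def)+
qed

end

text \<open>The coefficient ring \<open>\<int>[y]\<close> is \<^typ>\<open>int poly\<close>.\<close>

type_synonym ab_poly = "ab_word \<Rightarrow>\<^sub>0 int poly"

definition var :: "letter \<Rightarrow> ab_poly"
  where "var l = Poly_Mapping.single (Word [l]) 1"

definition scalar :: "int poly \<Rightarrow> ab_poly"
  where "scalar p = Poly_Mapping.single 0 p"


section \<open>Graded posets\<close>

text \<open>
  A poset is a set \<open>P\<close> of elements of a partially ordered type, with the induced order. Chains are
  the library's \<^const>\<open>pred_on.chain\<close> and \<^const>\<open>pred_on.maxchain\<close> with respect to \<open><\<close>; in
  particular \<open>pred_on.maxchain (P \<inter> {X..Y}) (<) C\<close> says that \<open>C\<close> is a maximal chain of \<open>P\<close> from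
  \<open>X\<close> to \<open>Y\<close>. \<open>LEAST X. X \<in> Q\<close> and \<open>GREATEST X. X \<in> Q\<close> are the minimum and maximum of \<open>Q\<close>.
\<close>

text \<open>The increasing enumeration of a finite chain \<open>C\<^sub>1 < \<dots> < C\<^sub>k\<close>, with 0-based list indices.\<close>

definition enum_chain :: "'a::order set \<Rightarrow> 'a list"
  where "enum_chain C = (THE xs. sorted_wrt (<) xs \<and> set xs = C)"

text \<open>The length of a nonempty chain \<open>C\<close> is \<open>card C - 1\<close>.\<close>

definition prank :: "'a::order set \<Rightarrow> 'a \<Rightarrow> nat"
  where "prank Q X =
    (THE r. \<forall>C. pred_on.maxchain (Q \<inter> {(LEAST Z. Z \<in> Q)..X}) (<) C \<longrightarrow> card C - 1 = r)"

definition graded_poset :: "'a::order set \<Rightarrow> nat \<Rightarrow> bool"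
  where "graded_poset P n \<longleftrightarrow>
    finite P \<and>
    (\<exists>X\<in>P. \<forall>Y\<in>P. X \<le> Y) \<and>
    (\<exists>Y\<in>P. \<forall>X\<in>P. X \<le> Y) \<and>
    (\<forall>X\<in>P. \<forall>C. pred_on.maxchain (P \<inter> {(LEAST Z. Z \<in> P)..X}) (<) C
            \<longrightarrow> card C - 1 = prank P X) \<and>
    prank P (GREATEST Z. Z \<in> P) = n"

definition covers :: "'a::order set \<Rightarrow> 'a \<Rightarrow> 'a \<Rightarrow> bool"
  where "covers P X Y \<longleftrightarrow> X \<in> P \<and> Y \<in> P \<and> X < Y \<and> \<not> (\<exists>Z\<in>P. X < Z \<and> Z < Y)"


section \<open>The extended ab-index\<close>

text \<open>The condition \<open>finite Q\<close> only serves to make the recursion terminate.\<close>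

function mobius :: "'a::order set \<Rightarrow> 'a \<Rightarrow> 'a \<Rightarrow> int"
  where "mobius Q X Y =
    (if X = Y then 1
     else if finite Q \<and> X < Y then - (\<Sum>Z\<in>{Z\<in>Q. X \<le> Z \<and> Z < Y}. mobius Q X Z)
     else 0)"
  by pat_completeness auto
termination
proof (relation "measure (\<lambda>(Q, X, Y). card {Z\<in>Q. X \<le> Z \<and> Z < Y})")
  fix Q :: "'a set" and X Y Z
  assume "finite Q \<and> X < Y" and Z: "Z \<in> {Z\<in>Q. X \<le> Z \<and> Z < Y}"
  then have "finite {Z\<in>Q. X \<le> Z \<and> Z < Y}"
    by simp
  moreover have "{W\<in>Q. X \<le> W \<and> W < Z} \<subset> {Z\<in>Q. X \<le> Z \<and> Z < Y}"
    using Z by (auto dest: less_trans)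
  ultimately show "((Q, X, Z), (Q, X, Y)) \<in> measure (\<lambda>(Q, X, Y). card {Z\<in>Q. X \<le> Z \<and> Z < Y})"
    by (simp add: psubset_card_mono)
qed simp

declare mobius.simps [simp del]

definition Poin :: "'a::order set \<Rightarrow> int poly"
  where "Poin Q = (\<Sum>X\<in>Q. monom \<bar>mobius Q (LEAST Z. Z \<in> Q) X\<bar> (prank Q X))"

definition chain_Poin :: "'a::order set \<Rightarrow> 'a set \<Rightarrow> int poly"
  where "chain_Poin P C =
    (let xs = enum_chain C @ [GREATEST Z. Z \<in> P]
     in \<Prod>i<card C. Poin (P \<inter> {xs ! i..xs ! Suc i}))"

definition wt :: "'a::order set \<Rightarrow> 'a set \<Rightarrow> ab_poly"
  where "wt P C =
    prod_list (map (\<lambda>i. if i \<in> prank P ` C then var B else var A - var B)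
                   [0..<prank P (GREATEST Z. Z \<in> P)])"

definition ex_ab_index :: "'a::order set \<Rightarrow> ab_poly"
  where "ex_ab_index P =
    (\<Sum>C\<in>{C. pred_on.chain (P - {GREATEST Z. Z \<in> P}) (<) C}. scalar (chain_Poin P C) * wt P C)"


section \<open>R-labelings and their words\<close>

definition chain_labels :: "('a::order \<Rightarrow> 'a \<Rightarrow> nat) \<Rightarrow> 'a set \<Rightarrow> nat list"
  where "chain_labels lam M =
    (let xs = enum_chain M in map (\<lambda>i. lam (xs ! i) (xs ! Suc i)) [0..<length xs - 1])"

text \<open>Values of \<open>lam\<close> on pairs that are not cover relations are irrelevant.\<close>

definition R_labeling :: "'a::order set \<Rightarrow> ('a \<Rightarrow> 'a \<Rightarrow> nat) \<Rightarrow> bool"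
  where "R_labeling P lam \<longleftrightarrow>
    (\<forall>X Y. covers P X Y \<longrightarrow> lam X Y > 0) \<and>
    (\<forall>X\<in>P. \<forall>Y\<in>P. X \<le> Y \<longrightarrow>
       (\<exists>!C. pred_on.maxchain (P \<inter> {X..Y}) (<) C \<and> sorted (chain_labels lam C)))"

text \<open>The letters \<open>u\<^sub>i\<close> and \<open>v\<^sub>i\<close>, meaningful for \<open>1 \<le> i \<le> n\<close>.\<close>

definition u_letter :: "('a::order \<Rightarrow> 'a \<Rightarrow> nat) \<Rightarrow> 'a set \<Rightarrow> nat \<Rightarrow> letter"
  where "u_letter lam M i =
    (let xs = enum_chain M in
     if i = 1 \<or> lam (xs ! (i - 2)) (xs ! (i - 1)) \<le> lam (xs ! (i - 1)) (xs ! i) then A else B)"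

definition v_letter :: "('a::order \<Rightarrow> 'a \<Rightarrow> nat) \<Rightarrow> 'a set \<Rightarrow> nat set \<Rightarrow> nat \<Rightarrow> letter"
  where "v_letter lam M E i =
    (if u_letter lam M i = A \<and> i \<notin> E \<or> u_letter lam M i = B \<and> i - 1 \<in> E then A else B)"

definition u_word :: "nat \<Rightarrow> ('a::order \<Rightarrow> 'a \<Rightarrow> nat) \<Rightarrow> 'a set \<Rightarrow> nat set \<Rightarrow> ab_poly"
  where "u_word n lam M E = prod_list (map (\<lambda>i. var (v_letter lam M E i)) [1..<Suc n])"

end

theory Submission
  imports Defs
begin

text \<open>
  Expand the words \<open>u(M, E)\<close> by \<open>a = (a - b) + b\<close>. A term \<open>b\<close> at an element \<open>X\<close> forgets how the
  chain reached \<open>X\<close>, so the elements where \<open>b\<close> is chosen form a chain \<open>C\<close> and the contribution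
  factors over the intervals of \<open>C\<close>. Inside such an interval \<open>a - b\<close> is chosen at every rank,
  which forces the labels of the maximal chain to fall strictly and then rise weakly, and \<open>E\<close> to
  consist of the steps of the falling run with or without the last one. In other words, the steps
  in \<open>E\<close> form a falling path and the other steps a rising continuation of it. The rising
  continuation is unique, and the falling paths are counted by the absolute value of the Moebius
  function, so the interval contributes its Poincare polynomial. Below the first element of \<open>C\<close>
  the initial letter \<open>a\<close> forces the chain to rise and \<open>E\<close> to be empty, which gives the factor 1.
\<close>

section \<open>Scalars\<close>

lemma scalar_0 [simp]: "scalar 0 = 0"
  and scalar_1 [simp]: "scalar 1 = 1"
  and scalar_add: "scalar (p + q) = scalar p + scalar q"
  and scalar_mult: "scalar (p * q) = scalar p * scalar q"
  by (simp_all add: scalar_def single_add mult_single)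

lemma scalar_sum: "scalar (\<Sum>x\<in>S. f x) = (\<Sum>x\<in>S. scalar (f x))"
  by (induction S rule: infinite_finite_induct) (simp_all add: scalar_add)

text \<open>Scalars sit at the empty word, which is neutral for concatenation, and coefficients
  commute. So \<open>scalar p\<close> commutes with single terms, and the induction adds one term at
  a time.\<close>

lemma scalar_commute: "scalar p * w = w * scalar p"
proof (induction w rule: update_induct)
  case (update f a b)
  have "Poly_Mapping.update a b f = f + Poly_Mapping.single a b"
    using update(1) by (intro poly_mapping_eqI)
      (auto simp: lookup_update lookup_add lookup_single when_def in_keys_iff)
  moreover have "scalar p * Poly_Mapping.single a b = Poly_Mapping.single a b * scalar p"
    by (simp add: scalar_def mult_single mult.commute)
  ultimately show ?case
    using update by (simp add: algebra_simps)
qed auto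

lemma scalar_left_commute: "v * (scalar p * w) = scalar p * (v * w)"
  by (metis scalar_commute mult.assoc)

section \<open>Chains as lists\<close>

text \<open>Both heads are the least element of the common set, hence equal. This makes the
  \<open>THE\<close> in \<open>enum_chain\<close> determined.\<close>

lemma strict_sorted_list_unique:
  fixes xs ys :: "'a::order list"
  assumes "sorted_wrt (<) xs" "sorted_wrt (<) ys" "set xs = set ys"
  shows "xs = ys"
  using assms
proof (induction xs arbitrary: ys)
  case (Cons x xs)
  then obtain y ys' where ys: "ys = y # ys'"
    by (cases ys) auto
  have "x \<in> insert y (set ys')" "y \<in> insert x (set xs)"
    using Cons.prems(3) by (auto simp: ys)
  then have "x = y"
    using Cons.prems(1,2) by (auto simp: ys dest: less_asym)
  moreover have "x \<notin> set xs" "y \<notin> set ys'"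
    using Cons.prems(1,2) by (auto simp: ys)
  ultimately have "set xs = set ys'"
    using Cons.prems(3) by (auto simp: ys)
  then show ?case
    using Cons \<open>x = y\<close> by (auto simp: ys)
qed auto

lemma enum_chain_set: "sorted_wrt (<) xs \<Longrightarrow> enum_chain (set xs) = xs"
  unfolding enum_chain_def by (rule the_equality) (auto intro: strict_sorted_list_unique)

lemma strict_sorted_distinct: "sorted_wrt (<) (xs :: 'a::order list) \<Longrightarrow> distinct xs"
  by (induction xs) auto

text \<open>A minimal element of a finite chain is its least element; removing it builds the list
  recursively.\<close>

lemma chain_iff_strict_sorted:
  fixes S :: "'a::order set"
  assumes "finite S"
  shows "pred_on.chain S (<) C \<longleftrightarrow> (\<exists>xs. sorted_wrt (<) xs \<and> set xs \<subseteq> S \<and> C = set xs)"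
proof
  assume C: "pred_on.chain S (<) C"
  then have sub: "C \<subseteq> S"
    by (simp add: pred_on.chain_def)
  then have "finite C"
    using assms finite_subset by blast
  then have "pred_on.chain S (<) C \<Longrightarrow> \<exists>xs. sorted_wrt (<) xs \<and> set xs = C"
  proof (induction C rule: finite_psubset_induct)
    case (psubset C)
    show ?case
    proof (cases "C = {}")
      case False
      then obtain m where m: "m \<in> C" "\<forall>x\<in>C. x \<le> m \<longrightarrow> m = x"
        using finite_has_minimal[OF psubset(1)] by blast
      have "pred_on.chain S (<) (C - {m})"
        using psubset.prems by (auto simp: pred_on.chain_def)
      then obtain xs where xs: "sorted_wrt (<) xs" "set xs = C - {m}"
        using psubset.IH[of "C - {m}"] m by blast
      have "\<forall>x\<in>C - {m}. m < x"
        using m psubset.prems unfolding pred_on.chain_def by (auto simp: order.order_iff_strict)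
      with xs m(1) have "sorted_wrt (<) (m # xs)" "set (m # xs) = C"
        by auto
      then show ?thesis
        by blast
    qed (auto intro: exI[of _ "[]"])
  qed
  then show "\<exists>xs. sorted_wrt (<) xs \<and> set xs \<subseteq> S \<and> C = set xs"
    using C sub by blast
next
  have "sorted_wrt (<) xs \<Longrightarrow> x \<in> set xs \<Longrightarrow> y \<in> set xs \<Longrightarrow> x < y \<or> x = y \<or> y < x"
    for xs :: "'a list" and x y
    by (induction xs) auto
  then show "\<exists>xs. sorted_wrt (<) xs \<and> set xs \<subseteq> S \<and> C = set xs \<Longrightarrow> pred_on.chain S (<) C"
    unfolding pred_on.chain_def by blast
qed

section \<open>Maximal chains of an interval as lists of successive covers\<close>

text \<open>The starting point \<open>X\<close> is kept out of the list: appending lists then joins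
  paths, and the length counts the steps.\<close>

fun saturated :: "'a::order set \<Rightarrow> 'a \<Rightarrow> 'a list \<Rightarrow> bool"
  where
    "saturated P X [] \<longleftrightarrow> True"
  | "saturated P X (Z # zs) \<longleftrightarrow> covers P X Z \<and> saturated P Z zs"

fun labels :: "('a \<Rightarrow> 'a \<Rightarrow> nat) \<Rightarrow> 'a \<Rightarrow> 'a list \<Rightarrow> nat list"
  where
    "labels lam X [] = []"
  | "labels lam X (Z # zs) = lam X Z # labels lam Z zs"

lemma length_labels [simp]: "length (labels lam X zs) = length zs"
  by (induction zs arbitrary: X) auto

lemma nth_labels: "i < length zs \<Longrightarrow> labels lam X zs ! i = lam ((X # zs) ! i) (zs ! i)"
  by (induction zs arbitrary: X i) (auto simp: nth_Cons split: nat.split)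

lemma saturated_subset: "saturated P X zs \<Longrightarrow> set zs \<subseteq> P"
  by (induction zs arbitrary: X) (auto simp: covers_def)

lemma saturated_sorted: "saturated P X zs \<Longrightarrow> sorted_wrt (<) (X # zs)"
proof (induction zs arbitrary: X)
  case (Cons Z zs)
  then have "X < Z" "sorted_wrt (<) (Z # zs)"
    by (auto simp: covers_def)
  then show ?case
    by (auto intro: less_trans)
qed auto

lemma saturated_append:
  "saturated P X (zs @ ws) \<longleftrightarrow> saturated P X zs \<and> saturated P (last (X # zs)) ws"
  by (induction zs arbitrary: X) auto

lemma strict_sorted_le_last:
  fixes X :: "'a::order"
  assumes "sorted_wrt (<) (X # zs)" "Z \<in> set (X # zs)"
  shows "Z \<le> last (X # zs)"
  using assms
proof (induction zs arbitrary: X Z)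
  case (Cons Y zs)
  have "Y \<le> last (Y # zs)"
    using Cons.prems(1) by (intro Cons.IH) auto
  moreover have "X < Y"
    using Cons.prems(1) by simp
  ultimately have "X \<le> last (Y # zs)"
    by order
  then show ?case
    using Cons by auto
qed auto

text \<open>Going up the list, \<open>d\<close> is either above the next element, where the
  induction applies, or strictly below it and then equal to \<open>X\<close>, since nothing lies
  inside a cover.\<close>

lemma saturated_comparable_mem:
  assumes "saturated P X zs" "d \<in> P" "X \<le> d" "d \<le> last (X # zs)"
    and "\<forall>x\<in>set (X # zs). d \<le> x \<or> x \<le> d"
  shows "d \<in> set (X # zs)"
  using assms
proof (induction zs arbitrary: X)
  case (Cons Z zs)
  then consider "Z \<le> d" | "d < Z"
    by (force simp: order.order_iff_strict)
  then show ?case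
  proof cases
    case 1
    then show ?thesis using Cons by auto
  next
    case 2
    then show ?thesis using Cons.prems by (auto simp: covers_def order.order_iff_strict)
  qed
qed auto

text \<open>An element strictly between two neighbours would be comparable with the whole list,
  hence a member of it, which the order of the list excludes.\<close>

lemma saturatedI:
  assumes "sorted_wrt (<) (X # zs)" "set (X # zs) \<subseteq> P"
    and "\<And>d. \<lbrakk>d \<in> P; X \<le> d; d \<le> last (X # zs); \<forall>x\<in>set (X # zs). d \<le> x \<or> x \<le> d\<rbrakk>
           \<Longrightarrow> d \<in> set (X # zs)"
  shows "saturated P X zs"
  using assms
proof (induction zs arbitrary: X)
  case (Cons Z zs)
  have le_last: "Z \<le> last (Z # zs)"
    using Cons.prems(1) by (intro strict_sorted_le_last) auto
  have "covers P X Z"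
  proof -
    have False if d: "d \<in> P" "X < d" "d < Z" for d
    proof -
      have above: "d < x" if "x \<in> set (Z # zs)" for x
        using that d(3) Cons.prems(1) by (auto intro: less_trans)
      then have "d \<in> set (X # Z # zs)"
        using d le_last by (intro Cons.prems(3)) (auto simp: less_imp_le)
      then show False
        using above d by auto
    qed
    then show ?thesis
      using Cons.prems(1,2) by (auto simp: covers_def)
  qed
  moreover have "saturated P Z zs"
  proof (rule Cons.IH)
    fix d
    assume d: "d \<in> P" "Z \<le> d" "d \<le> last (Z # zs)" "\<forall>x\<in>set (Z # zs). d \<le> x \<or> x \<le> d"
    have "X < d"
      using Cons.prems(1) d(2) by auto
    then have "d \<in> set (X # Z # zs)"
      using d by (intro Cons.prems(3)) auto
    then show "d \<in> set (Z # zs)"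
      using \<open>X < d\<close> by auto
  qed (use Cons.prems in auto)
  ultimately show ?case
    by simp
qed auto

lemma maxchain_interval_iff:
  fixes P :: "'a::order set"
  assumes "finite P" "X \<in> P" "Y \<in> P" "X \<le> Y"
  shows "pred_on.maxchain (P \<inter> {X..Y}) (<) C \<longleftrightarrow>
    (\<exists>zs. saturated P X zs \<and> last (X # zs) = Y \<and> C = set (X # zs))"
    (is "?L \<longleftrightarrow> ?R")
proof
  assume L: ?L
  have chain: "pred_on.chain (P \<inter> {X..Y}) (<) C"
    using L by (simp add: pred_on.maxchain_def)
  have mem: "d \<in> C" if "d \<in> P" "X \<le> d" "d \<le> Y" "\<forall>x\<in>C. d \<le> x \<or> x \<le> d" for d
  proof (rule ccontr)
    assume "d \<notin> C"
    moreover have "pred_on.chain (P \<inter> {X..Y}) (<) (insert d C)"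
      using chain that by (auto simp: pred_on.chain_def order.order_iff_strict)
    ultimately show False
      using L by (auto simp: pred_on.maxchain_def)
  qed
  obtain xs where xs: "sorted_wrt (<) xs" "set xs \<subseteq> P \<inter> {X..Y}" "C = set xs"
    using chain assms(1) by (subst (asm) chain_iff_strict_sorted) auto
  \<comment> \<open>The endpoints are comparable with everything in the interval, so maximality puts
    them into \<open>C\<close>.\<close>
  have "X \<in> C"
    using assms xs by (intro mem) auto
  have "Y \<in> C"
    using assms xs by (intro mem) auto
  obtain X' zs where X': "xs = X' # zs"
    using \<open>X \<in> C\<close> xs by (cases xs) auto
  have X: "xs = X # zs"
    using \<open>X \<in> C\<close> xs X' by (auto dest!: less_le_not_le[THEN iffD1])
  have "last xs \<in> set xs"
    using X by simp
  then have "last (X # zs) = Y"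
    using strict_sorted_le_last[of X zs Y] xs X \<open>Y \<in> C\<close> by (auto intro: order.antisym)
  moreover have "saturated P X zs"
    using xs X mem calculation by (intro saturatedI) auto
  ultimately show ?R
    using xs X by blast
next
  assume ?R
  then obtain zs where zs: "saturated P X zs" "last (X # zs) = Y" "C = set (X # zs)"
    by blast
  have sorted: "sorted_wrt (<) (X # zs)"
    using zs saturated_sorted by blast
  have "C \<subseteq> P \<inter> {X..Y}"
    using strict_sorted_le_last[OF sorted] saturated_subset[OF zs(1)] zs sorted assms
    by (auto simp: less_imp_le)
  then have "pred_on.chain (P \<inter> {X..Y}) (<) C"
    using sorted zs(3) assms(1)
    by (subst chain_iff_strict_sorted) (auto intro!: exI[of _ "X # zs"])
  moreover have False if D: "pred_on.chain (P \<inter> {X..Y}) (<) D" "C \<subset> D" for D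
  proof -
    obtain d where d: "d \<in> D" "d \<notin> C"
      using D(2) by blast
    have "d \<in> P" "X \<le> d" "d \<le> Y"
      using D(1) d(1) by (auto simp: pred_on.chain_def)
    moreover have "d \<le> x \<or> x \<le> d" if "x \<in> C" for x
    proof -
      have "x \<in> D" using that D(2) by blast
      then show ?thesis
        using D(1) d(1) unfolding pred_on.chain_def by (blast intro: less_imp_le)
    qed
    ultimately show False
      using saturated_comparable_mem[OF zs(1), of d] zs(2,3) d(2) by blast
  qed
  ultimately show ?L
    by (auto simp: pred_on.maxchain_def)
qed

lemma chain_labels_set:
  assumes "sorted_wrt (<) (X # zs)"
  shows "chain_labels lam (set (X # zs)) = labels lam X zs"
  unfolding chain_labels_def enum_chain_set[OF assms] Let_def
  by (rule nth_equalityI) (auto simp: nth_labels)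


section \<open>Ranks and labelled paths\<close>

locale R_labeled_poset =
  fixes P :: "'a::order set" and n :: nat and lam :: "'a \<Rightarrow> 'a \<Rightarrow> nat"
  assumes graded: "graded_poset P n" and R_lab: "R_labeling P lam"
begin

definition bot :: 'a where "bot = (LEAST Z. Z \<in> P)"
definition top :: 'a where "top = (GREATEST Z. Z \<in> P)"
abbreviation rk :: "'a \<Rightarrow> nat" where "rk \<equiv> prank P"

lemma finite_P: "finite P"
  using graded by (simp add: graded_poset_def)

lemma bot: "bot \<in> P" "X \<in> P \<Longrightarrow> bot \<le> X"
proof -
  obtain Z where "Z \<in> P" "\<forall>Y\<in>P. Z \<le> Y"
    using graded by (auto simp: graded_poset_def)
  moreover from this have "bot = Z"
    unfolding bot_def by (intro Least_equality) auto
  ultimately show "bot \<in> P" "X \<in> P \<Longrightarrow> bot \<le> X"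
    by auto
qed

lemma top: "top \<in> P" "X \<in> P \<Longrightarrow> X \<le> top"
proof -
  obtain Z where "Z \<in> P" "\<forall>Y\<in>P. Y \<le> Z"
    using graded by (auto simp: graded_poset_def)
  moreover from this have "top = Z"
    unfolding top_def by (intro Greatest_equality) auto
  ultimately show "top \<in> P" "X \<in> P \<Longrightarrow> X \<le> top"
    by auto
qed

lemma less_top: "X \<in> P \<Longrightarrow> X \<noteq> top \<Longrightarrow> X < top"
  using top by (auto simp: order.order_iff_strict)

lemma rk_top: "rk top = n"
  using graded by (simp add: graded_poset_def top_def)

definition paths :: "'a \<Rightarrow> 'a \<Rightarrow> 'a list set"
  where "paths X Y = {zs. saturated P X zs \<and> last (X # zs) = Y}"

lemma maxchain_paths:
  assumes "X \<in> P" "Y \<in> P" "X \<le> Y"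
  shows "pred_on.maxchain (P \<inter> {X..Y}) (<) C \<longleftrightarrow> (\<exists>zs\<in>paths X Y. C = set (X # zs))"
  using maxchain_interval_iff[OF finite_P assms] by (auto simp: paths_def)

lemma finite_paths: "finite (paths X Y)"
proof (rule finite_subset[OF _ finite_subset_distinct[OF finite_P]])
  show "paths X Y \<subseteq> {zs. set zs \<subseteq> P \<and> distinct zs}"
    using saturated_subset strict_sorted_distinct[OF saturated_sorted]
    unfolding paths_def by fastforce
qed

lemma paths_sorted: "zs \<in> paths X Y \<Longrightarrow> sorted_wrt (<) (X # zs)"
  unfolding paths_def by (blast intro: saturated_sorted)

lemma paths_le: "zs \<in> paths X Y \<Longrightarrow> X \<le> Y"
  using strict_sorted_le_last[of X zs X] paths_sorted[of zs X Y] by (simp add: paths_def)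

lemma paths_refl [simp]: "paths X X = {[]}"
proof -
  have "zs = []" if "zs \<in> paths X X" for zs
    using that paths_sorted[OF that] by (cases zs rule: rev_cases) (auto simp: paths_def)
  moreover have "[] \<in> paths X X"
    by (simp add: paths_def)
  ultimately show ?thesis
    by blast
qed

lemma card_path: "zs \<in> paths X Y \<Longrightarrow> card (set (X # zs)) = Suc (length zs)"
  using distinct_card[OF strict_sorted_distinct[OF paths_sorted]] by (metis length_Cons)

text \<open>The defining property of an R-labeling, carried from chains as sets to paths as lists;
  uniqueness survives because a strictly sorted list is determined by its set.\<close>

lemma ex1_increasing_path:
  assumes "X \<in> P" "Y \<in> P" "X \<le> Y"
  shows "\<exists>!zs. zs \<in> paths X Y \<and> sorted (labels lam X zs)"
proof -
  have "\<exists>!C. pred_on.maxchain (P \<inter> {X..Y}) (<) C \<and> sorted (chain_labels lam C)"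
    using R_lab assms by (auto simp: R_labeling_def)
  then obtain C where C: "pred_on.maxchain (P \<inter> {X..Y}) (<) C" "sorted (chain_labels lam C)"
    and uniq: "\<And>D. pred_on.maxchain (P \<inter> {X..Y}) (<) D \<Longrightarrow> sorted (chain_labels lam D) \<Longrightarrow> D = C"
    by blast
  obtain zs where zs: "zs \<in> paths X Y" "C = set (X # zs)"
    using C assms by (auto simp: maxchain_paths)
  show ?thesis
  proof (rule ex1I[of _ zs])
    show "zs \<in> paths X Y \<and> sorted (labels lam X zs)"
      using C(2) zs chain_labels_set[OF paths_sorted[OF zs(1)]] by metis
  next
    fix ws
    assume ws: "ws \<in> paths X Y \<and> sorted (labels lam X ws)"
    then have "pred_on.maxchain (P \<inter> {X..Y}) (<) (set (X # ws))"
      using maxchain_paths[OF assms] by blast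
    moreover have "sorted (chain_labels lam (set (X # ws)))"
      using ws chain_labels_set[OF paths_sorted[of ws X Y]] by metis
    ultimately have "set (X # ws) = C"
      by (rule uniq)
    then have "X # ws = X # zs"
      using ws zs paths_sorted by (metis strict_sorted_list_unique)
    then show "ws = zs"
      by simp
  qed
qed

lemma paths_nonempty: "X \<in> P \<Longrightarrow> Y \<in> P \<Longrightarrow> X \<le> Y \<Longrightarrow> paths X Y \<noteq> {}"
  using ex1_increasing_path by blast

lemma length_path_bot: "X \<in> P \<Longrightarrow> zs \<in> paths bot X \<Longrightarrow> length zs = rk X"
proof -
  assume "X \<in> P" "zs \<in> paths bot X"
  then have "card (set (bot # zs)) - 1 = rk X"
    using graded maxchain_paths[OF bot(1) _ bot(2), of X "set (bot # zs)"]
    unfolding graded_poset_def bot_def[symmetric] by blast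
  then show ?thesis
    using card_path[OF \<open>zs \<in> paths bot X\<close>] by simp
qed

lemma paths_append: "zs \<in> paths X Y \<Longrightarrow> ws \<in> paths Y Z \<Longrightarrow> zs @ ws \<in> paths X Z"
  by (auto simp: paths_def saturated_append last_append)

text \<open>A path from \<open>bot\<close> to \<open>X\<close> put in front reduces this to paths
  from \<open>bot\<close>, whose lengths are ranks.\<close>

lemma length_path:
  assumes "X \<in> P" "Y \<in> P" "zs \<in> paths X Y"
  shows "rk Y = rk X + length zs"
proof -
  obtain ws where "ws \<in> paths bot X"
    using paths_nonempty[OF bot(1) assms(1)] bot(2) assms(1) by auto
  then show ?thesis
    using length_path_bot[of X ws] length_path_bot[of Y "ws @ zs"] assms paths_append by auto
qed

lemma rk_less: "X \<in> P \<Longrightarrow> Y \<in> P \<Longrightarrow> X < Y \<Longrightarrow> rk X < rk Y"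
proof -
  assume *: "X \<in> P" "Y \<in> P" "X < Y"
  then obtain zs where zs: "zs \<in> paths X Y"
    using paths_nonempty[of X Y] by (auto simp: less_imp_le)
  then have "zs \<noteq> []"
    using * by (auto simp: paths_def)
  then show ?thesis
    using length_path[OF *(1,2) zs] by simp
qed

lemma rk_mono: "X \<in> P \<Longrightarrow> Y \<in> P \<Longrightarrow> X \<le> Y \<Longrightarrow> rk X \<le> rk Y"
  using rk_less by (auto simp: order.order_iff_strict)

lemma rk_bot: "rk bot = 0"
  using length_path_bot[OF bot(1), of "[]"] by simp

lemma rk_covers: "covers P X Z \<Longrightarrow> rk Z = Suc (rk X)"
  using length_path[of X Z "[Z]"] by (auto simp: paths_def covers_def)

lemma Least_interval: "X \<in> P \<Longrightarrow> X \<le> Y \<Longrightarrow> (LEAST Z. Z \<in> P \<inter> {X..Y}) = X"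
  by (rule Least_equality) auto

lemma prank_interval:
  assumes "X \<in> P" "Z \<in> P \<inter> {X..Y}"
  shows "prank (P \<inter> {X..Y}) Z = rk Z - rk X"
proof -
  have Z: "Z \<in> P" "X \<le> Z" "Z \<le> Y"
    using assms by auto
  have eq: "P \<inter> {X..Y} \<inter> {(LEAST W. W \<in> P \<inter> {X..Y})..Z} = P \<inter> {X..Z}"
    using Least_interval[of X Y] assms by auto
  have card: "card C - 1 = rk Z - rk X" if C: "pred_on.maxchain (P \<inter> {X..Z}) (<) C" for C
  proof -
    obtain zs where zs: "zs \<in> paths X Z" "C = set (X # zs)"
      using C maxchain_paths[OF assms(1) Z(1,2)] by blast
    then show ?thesis
      using card_path[OF zs(1)] length_path[OF assms(1) Z(1) zs(1)] by simp
  qed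
  \<comment> \<open>At least one maximal chain must exist for the \<open>THE\<close> in
    \<open>prank\<close> to be determined.\<close>
  obtain zs where "zs \<in> paths X Z"
    using paths_nonempty[OF assms(1) Z(1,2)] by blast
  then have "pred_on.maxchain (P \<inter> {X..Z}) (<) (set (X # zs))"
    using maxchain_paths[OF assms(1) Z(1,2)] by blast
  then show ?thesis
    unfolding prank_def[of "P \<inter> {X..Y}"] eq by (intro the_equality) (use card in blast)+
qed

definition cov :: "'a \<Rightarrow> 'a set"
  where "cov X = {Z. covers P X Z}"

lemma finite_cov: "finite (cov X)"
  by (rule finite_subset[OF _ finite_P]) (auto simp: cov_def covers_def)

lemma paths_step:
  assumes "X \<noteq> Y"
  shows "paths X Y = (\<Union>Z\<in>cov X. (#) Z ` paths Z Y)"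
proof (intro set_eqI)
  fix zs
  show "zs \<in> paths X Y \<longleftrightarrow> zs \<in> (\<Union>Z\<in>cov X. (#) Z ` paths Z Y)"
    using assms by (cases zs) (auto simp: paths_def cov_def)
qed

lemma sum_paths_step:
  assumes "X \<noteq> Y"
  shows "(\<Sum>zs\<in>paths X Y. f zs) = (\<Sum>Z\<in>cov X. \<Sum>zs\<in>paths Z Y. f (Z # zs))"
  unfolding paths_step[OF assms]
  by (subst sum.UNION_disjoint) (auto simp: finite_cov finite_paths sum.reindex)

section \<open>Counting increasing and decreasing paths\<close>

text \<open>\<open>l\<close> stands for the label of a step arriving at \<open>X\<close>; with it
  the count recurses on the first step of the path.\<close>

definition path_count :: "(nat \<Rightarrow> nat \<Rightarrow> bool) \<Rightarrow> nat \<Rightarrow> 'a \<Rightarrow> 'a \<Rightarrow> int"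
  where "path_count r l X Y =
    (\<Sum>zs\<in>paths X Y. if successively r (l # labels lam X zs) then 1 else 0)"

abbreviation inc :: "nat \<Rightarrow> 'a \<Rightarrow> 'a \<Rightarrow> int" where "inc \<equiv> path_count (\<le>)"
abbreviation dec :: "nat \<Rightarrow> 'a \<Rightarrow> 'a \<Rightarrow> int" where "dec \<equiv> path_count (>)"

lemma path_count_refl [simp]: "path_count r l X X = 1"
  by (simp add: path_count_def)

lemma path_count_not_le: "\<not> X \<le> Y \<Longrightarrow> path_count r l X Y = 0"
  using paths_le by (auto simp: path_count_def intro!: sum.neutral)

lemma path_count_le: "path_count r l X Y \<noteq> 0 \<Longrightarrow> X \<le> Y"
  using path_count_not_le by blast

lemma path_count_nonneg: "path_count r l X Y \<ge> 0"
  by (auto simp: path_count_def intro!: sum_nonneg)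

lemma path_count_step:
  assumes "X \<noteq> Y"
  shows "path_count r l X Y = (\<Sum>Z\<in>{Z\<in>cov X. r l (lam X Z)}. path_count r (lam X Z) Z Y)"
  unfolding path_count_def sum_paths_step[OF assms]
  by (simp add: sum.inter_filter[OF finite_cov]) (intro sum.cong; simp)

text \<open>The incoming label 0 is below all labels and imposes nothing, so this counts the
  increasing paths, of which an R-labeling has exactly one.\<close>

lemma inc_0: "X \<in> P \<Longrightarrow> Y \<in> P \<Longrightarrow> X \<le> Y \<Longrightarrow> inc 0 X Y = 1"
proof -
  assume "X \<in> P" "Y \<in> P" "X \<le> Y"
  then obtain zs where "{zs \<in> paths X Y. sorted (labels lam X zs)} = {zs}"
    using ex1_increasing_path[of X Y] by blast
  moreover have "successively (\<le>) (0 # labels lam X zs) \<longleftrightarrow> sorted (labels lam X zs)" for zs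
    by (simp add: successively_conv_sorted_wrt)
  ultimately show ?thesis
    by (simp add: path_count_def sum.inter_filter[OF finite_paths, symmetric])
qed

text \<open>The length generating function of the falling initial parts of those paths from \<open>X\<close> to \<open>Y\<close>
  that first fall (starting below \<open>l\<close>) and then rise: by \<open>inc_0\<close> the rising part is determined by
  the turning point.\<close>

definition fall_poly :: "nat \<Rightarrow> 'a \<Rightarrow> 'a \<Rightarrow> int poly"
  where "fall_poly l X Y = (\<Sum>W\<in>P \<inter> {X..Y}. monom (dec l X W) (rk W - rk X))"

lemma fall_poly_not_le: "\<not> X \<le> Y \<Longrightarrow> fall_poly l X Y = 0"
  by (auto simp: fall_poly_def intro!: sum.neutral)

lemma fall_poly_refl: "X \<in> P \<Longrightarrow> fall_poly l X X = 1"
proof -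
  assume "X \<in> P"
  then have "P \<inter> {X..X} = {X}"
    by auto
  then show ?thesis
    by (simp add: fall_poly_def monom_eq_1)
qed

text \<open>The turning point \<open>W = X\<close> gives the term 1. Any other turning point is
  reached through a first falling step to some \<open>Z\<close>, which costs one factor y, here
  \<open>monom 1 1\<close>.\<close>

lemma fall_poly_step:
  assumes "X \<in> P" "Y \<in> P" "X \<le> Y"
  shows "fall_poly l X Y = 1 + monom 1 1 * (\<Sum>Z\<in>{Z\<in>cov X. lam X Z < l}. fall_poly (lam X Z) Z Y)"
proof -
  let ?C = "{Z\<in>cov X. lam X Z < l}" and ?I = "P \<inter> {X..Y} - {X}"
  have "fall_poly l X Y = monom (dec l X X) 0 + (\<Sum>W\<in>?I. monom (dec l X W) (rk W - rk X))"
    unfolding fall_poly_def using assms finite_P by (subst sum.remove[of _ X]) auto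
  also have "(\<Sum>W\<in>?I. monom (dec l X W) (rk W - rk X)) =
      (\<Sum>W\<in>?I. \<Sum>Z\<in>?C. monom (dec (lam X Z) Z W) (rk W - rk X))"
    by (intro sum.cong) (auto simp: path_count_step monom_sum)
  also have "\<dots> = (\<Sum>Z\<in>?C. \<Sum>W\<in>?I. monom (dec (lam X Z) Z W) (rk W - rk X))"
    by (rule sum.swap)
  also have "\<dots> = (\<Sum>Z\<in>?C. monom 1 1 * fall_poly (lam X Z) Z Y)"
  proof (rule sum.cong)
    fix Z assume "Z \<in> ?C"
    then have Z: "covers P X Z" "X < Z" "Z \<in> P"
      by (auto simp: cov_def covers_def)
    \<comment> \<open>The omitted \<open>W\<close> are not above \<open>Z\<close>, so no path from
      \<open>Z\<close> reaches them.\<close>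
    have "(\<Sum>W\<in>?I. monom (dec (lam X Z) Z W) (rk W - rk X)) =
        (\<Sum>W\<in>P \<inter> {Z..Y}. monom (dec (lam X Z) Z W) (rk W - rk X))"
      using Z finite_P by (intro sum.mono_neutral_right) (auto dest: path_count_le)
    also have "\<dots> = (\<Sum>W\<in>P \<inter> {Z..Y}. monom 1 1 * monom (dec (lam X Z) Z W) (rk W - rk Z))"
    proof (rule sum.cong)
      fix W assume "W \<in> P \<inter> {Z..Y}"
      then have "rk W - rk X = Suc (rk W - rk Z)"
        using rk_mono[of Z W] rk_covers[OF Z(1)] Z by auto
      then show "monom (dec (lam X Z) Z W) (rk W - rk X) =
          monom 1 1 * monom (dec (lam X Z) Z W) (rk W - rk Z)"
        by (simp add: mult_monom)
    qed simp
    finally show "(\<Sum>W\<in>?I. monom (dec (lam X Z) Z W) (rk W - rk X)) =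
        monom 1 1 * fall_poly (lam X Z) Z Y"
      by (simp add: fall_poly_def sum_distrib_left)
  qed simp
  finally show ?thesis
    by (simp add: sum_distrib_left monom_eq_1)
qed

section \<open>Falling paths, the Moebius function and the Poincare polynomial\<close>

lemma up_induct [consumes 1, case_names step]:
  assumes "X \<in> P"
    and "\<And>X. X \<in> P \<Longrightarrow> (\<And>Z. Z \<in> P \<Longrightarrow> X < Z \<Longrightarrow> Q Z) \<Longrightarrow> Q X"
  shows "Q X"
  using assms(1)
proof (induction "n - rk X" arbitrary: X rule: less_induct)
  case less
  show ?case
  proof (rule assms(2)[OF less.prems])
    fix Z assume Z: "Z \<in> P" "X < Z"
    then have "rk X < rk Z" "rk Z \<le> n"
      using rk_less less.prems rk_mono[OF Z(1) top(1) top(2)] rk_top by auto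
    then show "Q Z"
      using Z by (intro less.hyps) auto
  qed
qed

text \<open>At \<open>y = -1\<close> the paths that fall and then rise cancel in pairs, according to whether the step
  at the turning point is counted as a falling or a rising one.\<close>

lemma poly_fall_poly_minus_1:
  assumes "X \<in> P" "Y \<in> P"
  shows "poly (fall_poly l X Y) (-1) = inc l X Y"
  using assms
proof (induction X arbitrary: l rule: up_induct)
  case (step X)
  consider "\<not> X \<le> Y" | "X = Y" | "X < Y"
    by (auto simp: order.order_iff_strict)
  then show ?case
  proof cases
    case 1
    then show ?thesis by (simp add: fall_poly_not_le path_count_not_le)
  next
    case 2
    have "{Y..Y} \<inter> P = {Y}" using step.prems by auto
    then show ?thesis using 2 by (simp add: fall_poly_def Int_commute)
  next
    case 3
    have cov: "Z \<in> P \<and> X < Z" if "Z \<in> cov X" for Z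
      using that by (auto simp: cov_def covers_def)
    have "poly (fall_poly l X Y) (-1) = 1 - (\<Sum>Z\<in>{Z\<in>cov X. lam X Z < l}. inc (lam X Z) Z Y)"
      using 3 step.hyps step.prems cov
      by (subst fall_poly_step) (auto simp: poly_monom poly_sum step.IH)
    \<comment> \<open>The incoming label 0 admits every first step, so the sum counts all increasing
      paths from \<open>X\<close> to \<open>Y\<close>.\<close>
    moreover have "(\<Sum>Z\<in>cov X. inc (lam X Z) Z Y) = 1"
      using inc_0[of X Y] path_count_step[of X Y "(\<le>)" 0] 3 step by auto
    \<comment> \<open>First steps with label at least \<open>l\<close> make up
      \<open>inc l X Y\<close>; the others are the subtracted sum above.\<close>
    moreover have "(\<Sum>Z\<in>cov X. inc (lam X Z) Z Y) =
        (\<Sum>Z\<in>{Z\<in>cov X. lam X Z < l}. inc (lam X Z) Z Y) + inc l X Y"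
      using 3 finite_cov
      by (subst path_count_step[of X Y "(\<le>)" l], simp, subst sum.union_disjoint[symmetric])
        (auto intro!: sum.cong)
    ultimately show ?thesis
      by simp
  qed
qed

text \<open>As the incoming label, it turns every first step of a path into a fall.\<close>

definition max_label :: nat
  where "max_label = Suc (Max (insert 0 ((\<lambda>(X, Z). lam X Z) ` (P \<times> P))))"

lemma lam_less_max_label: "Z \<in> cov X \<Longrightarrow> lam X Z < max_label"
proof -
  assume "Z \<in> cov X"
  then have "lam X Z \<in> (\<lambda>(X, Z). lam X Z) ` (P \<times> P)"
    by (force simp: cov_def covers_def)
  then show ?thesis
    unfolding max_label_def using finite_P by (auto intro!: le_imp_less_Suc Max_ge)
qed

text \<open>No nontrivial path rises from \<open>max_label\<close>, so
  \<open>fall_poly max_label X Z\<close> vanishes at -1 for \<open>X < Z\<close>. Hence the signed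
  counts of falling paths sum to 0 over each such interval, which is the recursion that defines the
  Moebius function.\<close>

lemma mobius_interval:
  assumes "X \<in> P" "Z \<in> P \<inter> {X..Y}"
  shows "mobius (P \<inter> {X..Y}) X Z = (-1) ^ (rk Z - rk X) * dec max_label X Z"
  using assms(2)
proof (induction "rk Z" arbitrary: Z rule: less_induct)
  case less
  then have Z: "Z \<in> P" "X \<le> Z" "Z \<le> Y"
    by auto
  show ?case
  proof (cases "X = Z")
    case True
    then show ?thesis by (simp add: mobius.simps)
  next
    case False
    then have "X < Z" using Z by auto
    have set_eq: "{W \<in> P \<inter> {X..Y}. X \<le> W \<and> W < Z} = P \<inter> {X..Z} - {Z}"
      using Z by auto
    have "inc max_label X Z = 0"
      using False lam_less_max_label by (subst path_count_step) (auto intro!: sum.neutral dest: leD)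
    then have "0 = poly (fall_poly max_label X Z) (-1)"
      using poly_fall_poly_minus_1 assms(1) Z(1) by simp
    also have "\<dots> = (\<Sum>W\<in>P \<inter> {X..Z}. (-1) ^ (rk W - rk X) * dec max_label X W)"
      by (simp add: fall_poly_def poly_sum poly_monom mult.commute)
    also have "\<dots> = (-1) ^ (rk Z - rk X) * dec max_label X Z +
        (\<Sum>W\<in>P \<inter> {X..Z} - {Z}. (-1) ^ (rk W - rk X) * dec max_label X W)"
      using Z finite_P by (subst sum.remove[of _ Z]) auto
    also have "(\<Sum>W\<in>P \<inter> {X..Z} - {Z}. (-1) ^ (rk W - rk X) * dec max_label X W) =
        (\<Sum>W\<in>P \<inter> {X..Z} - {Z}. mobius (P \<inter> {X..Y}) X W)"
      using Z rk_less by (intro sum.cong less.hyps[symmetric]) (auto simp: less_le)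
    finally show ?thesis
      using False \<open>X < Z\<close> finite_P by (subst mobius.simps) (simp only: set_eq, simp)
  qed
qed

text \<open>Counts are nonnegative, so the absolute value just removes the sign in
  \<open>mobius_interval\<close>.\<close>

lemma Poin_interval:
  assumes "X \<in> P" "X \<le> Y"
  shows "Poin (P \<inter> {X..Y}) = fall_poly max_label X Y"
  unfolding Poin_def fall_poly_def Least_interval[OF assms]
proof (rule sum.cong)
  fix Z assume "Z \<in> P \<inter> {X..Y}"
  then show "monom \<bar>mobius (P \<inter> {X..Y}) X Z\<bar> (prank (P \<inter> {X..Y}) Z) =
      monom (dec max_label X Z) (rk Z - rk X)"
    by (simp only: mobius_interval[OF assms(1)] prank_interval[OF assms(1)] abs_mult power_abs
        abs_neg_one power_one mult_1 abs_of_nonneg[OF path_count_nonneg])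
qed simp

end

section \<open>Words along a path\<close>

text \<open>The letter at a rank whose incoming and outgoing steps have labels \<open>l\<close>, \<open>c\<close> and membership
  in \<open>E\<close> recorded by \<open>e\<close>, \<open>e'\<close>.\<close>

definition step_letter :: "nat \<Rightarrow> nat \<Rightarrow> bool \<Rightarrow> bool \<Rightarrow> ab_poly"
  where "step_letter l c e e' = (if l \<le> c \<and> \<not> e' \<or> \<not> l \<le> c \<and> e then var A else var B)"

text \<open>The two summands leave the first step out of \<open>E\<close> or put it in, the latter
  with weight y. \<open>l\<close> and \<open>e\<close> describe the step before the first
  one.\<close>

fun word_sum :: "nat \<Rightarrow> bool \<Rightarrow> nat list \<Rightarrow> ab_poly"
  where
    "word_sum l e [] = 1"
  | "word_sum l e (c # cs) =
      step_letter l c e False * word_sum c False cs +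
      scalar (monom 1 1) * (step_letter l c e True * word_sum c True cs)"

lemma sum_Pow_insert:
  assumes "finite S" "a \<notin> S"
  shows "(\<Sum>E\<in>Pow (insert a S). f E) = (\<Sum>E\<in>Pow S. f E) + (\<Sum>E\<in>Pow S. f (insert a E))"
proof -
  have "inj_on (insert a) (Pow S)"
    using assms(2) by (auto simp: inj_on_def)
  then show ?thesis
    using assms unfolding Pow_insert
    by (subst sum.union_disjoint) (auto simp: sum.reindex)
qed

text \<open>The recursion decides membership in \<open>E\<close> step by step. The steps are
  numbered from \<open>Suc m\<close> on, so that the induction passes to the tail without
  renumbering \<open>E\<close>.\<close>

lemma word_sum_eq:
  "word_sum l e cs = (\<Sum>E\<in>Pow {Suc m..m + length cs}. scalar (monom 1 (card E)) *
     prod_list (map (\<lambda>i. step_letter ((l # cs) ! i) (cs ! i)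
       (if i = 0 then e else m + i \<in> E) (Suc (m + i) \<in> E)) [0..<length cs]))"
proof (induction cs arbitrary: l e m)
  case (Cons c cs)
  define w where "w = (\<lambda>l e cs m E. prod_list (map (\<lambda>i. step_letter ((l # cs) ! i) (cs ! i)
       (if i = 0 then e else m + i \<in> E) (Suc (m + i) \<in> E)) [0..<length cs]))"
  let ?S = "{Suc (Suc m)..Suc m + length cs}"
  have IH: "word_sum c e' cs = (\<Sum>E\<in>Pow ?S. scalar (monom 1 (card E)) * w c e' cs (Suc m) E)" for e'
    unfolding w_def by (rule Cons.IH)
  have w_Cons: "w l e (c # cs) m E = step_letter l c e (Suc m \<in> E) * w c (Suc m \<in> E) cs (Suc m) E" for E
  proof -
    have "map (\<lambda>i. step_letter ((l # c # cs) ! i) ((c # cs) ! i)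
          (if i = 0 then e else m + i \<in> E) (Suc (m + i) \<in> E)) [0..<length (c # cs)] =
        step_letter l c e (Suc m \<in> E) # map (\<lambda>i. step_letter ((c # cs) ! i) (cs ! i)
          (if i = 0 then Suc m \<in> E else Suc m + i \<in> E) (Suc (Suc m + i) \<in> E)) [0..<length cs]"
      unfolding length_Cons upt_conv_Cons[OF zero_less_Suc] map_Suc_upt[symmetric] by simp
    then show ?thesis
      by (simp only: w_def prod_list.Cons)
  qed
  \<comment> \<open>The word of the tail never tests \<open>Suc m\<close>: at its first letter the
    argument \<open>True\<close> is read instead.\<close>
  have w_cong: "w c True cs (Suc m) (insert (Suc m) E) = w c True cs (Suc m) E" for E
    unfolding w_def by (auto intro!: arg_cong[where f = prod_list] map_cong)
  have interval: "{Suc m..m + length (c # cs)} = insert (Suc m) ?S"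
    by auto
  have notin: "Suc m \<notin> E" "card (insert (Suc m) E) = Suc (card E)" if "E \<in> Pow ?S" for E
  proof -
    show "Suc m \<notin> E" using that by auto
    then show "card (insert (Suc m) E) = Suc (card E)"
      using that finite_subset[of E ?S] by auto
  qed
  have "(\<Sum>E\<in>Pow {Suc m..m + length (c # cs)}. scalar (monom 1 (card E)) * w l e (c # cs) m E) =
      (\<Sum>E\<in>Pow ?S. scalar (monom 1 (card E)) * (step_letter l c e False * w c False cs (Suc m) E)) +
      (\<Sum>E\<in>Pow ?S. scalar (monom 1 (Suc (card E))) *
         (step_letter l c e True * w c True cs (Suc m) E))"
    unfolding interval by (subst sum_Pow_insert) (auto simp: w_Cons w_cong notin)
  also have "(\<Sum>E\<in>Pow ?S. scalar (monom 1 (card E)) * (step_letter l c e False * w c False cs (Suc m) E)) =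
      step_letter l c e False * word_sum c False cs"
    unfolding IH sum_distrib_left by (simp only: scalar_left_commute)
  also have "(\<Sum>E\<in>Pow ?S. scalar (monom 1 (Suc (card E))) *
         (step_letter l c e True * w c True cs (Suc m) E)) =
      scalar (monom 1 1) * (step_letter l c e True * word_sum c True cs)"
  proof -
    have "scalar (monom 1 (Suc k)) * (v * w) = scalar (monom 1 1) * (v * (scalar (monom 1 k) * w))"
      for k v w
    proof -
      have "monom 1 (Suc k) = monom 1 1 * (monom 1 k :: int poly)"
        by (simp add: mult_monom)
      then show ?thesis
        by (simp only: scalar_mult mult.assoc scalar_left_commute[of v])
    qed
    then show ?thesis
      unfolding IH sum_distrib_left by simp
  qed
  finally show ?case
    by (simp add: w_def)
qed simp

text \<open>The start values 0 and \<open>False\<close> encode the convention for the first letter: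
  0 is at most every label, so it is a before \<open>E\<close> is applied, and only the membership
  of 1 in \<open>E\<close> can change it.\<close>

lemma sum_u_word:
  assumes "sorted_wrt (<) (X # zs)" "length zs = n"
  shows "(\<Sum>E\<in>Pow {1..n}. scalar (monom 1 (card E)) * u_word n lam (set (X # zs)) E) =
    word_sum 0 False (labels lam X zs)"
proof -
  let ?cs = "labels lam X zs"
  have "var (v_letter lam (set (X # zs)) E (Suc i)) =
      step_letter ((0 # ?cs) ! i) (?cs ! i) (if i = 0 then False else 0 + i \<in> E) (Suc (0 + i) \<in> E)"
    if "i < n" for i E
    using that assms(2) unfolding v_letter_def u_letter_def enum_chain_set[OF assms(1)]
    by (cases i) (auto simp: step_letter_def nth_labels Let_def)
  then have "u_word n lam (set (X # zs)) E =
      prod_list (map (\<lambda>i. step_letter ((0 # ?cs) ! i) (?cs ! i)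
       (if i = 0 then False else 0 + i \<in> E) (Suc (0 + i) \<in> E)) [0..<length ?cs])" for E
    unfolding u_word_def One_nat_def map_Suc_upt[symmetric]
    using assms(2) by (auto simp: o_def intro!: arg_cong[where f = prod_list] map_cong)
  then show ?thesis
    using assms(2) by (subst word_sum_eq[of _ _ _ 0]) simp
qed

section \<open>Expanding the path sums along a = (a - b) + b\<close>

context R_labeled_poset
begin

text \<open>The words include the letter at \<open>X\<close>, which depends on the step arriving
  there; \<open>l\<close> is its label and \<open>e\<close> its membership in
  \<open>E\<close>.\<close>

definition path_sum :: "nat \<Rightarrow> bool \<Rightarrow> 'a \<Rightarrow> ab_poly"
  where "path_sum l e X = (\<Sum>zs\<in>paths X top. word_sum l e (labels lam X zs))"

text \<open>\<open>tail_sum max_label X\<close> collects the words from \<open>X\<close> on without their letter at \<open>X\<close>. Smaller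
  bounds \<open>l\<close> occur in \<open>path_sum_True_step\<close>.\<close>

definition tail_sum :: "nat \<Rightarrow> 'a \<Rightarrow> ab_poly"
  where "tail_sum l X = (\<Sum>Z\<in>cov X. path_sum (lam X Z) False Z +
    (if lam X Z < l then scalar (monom 1 1) * path_sum (lam X Z) True Z else 0))"

text \<open>The letter at \<open>X\<close> is replaced by b, so the arriving step no longer matters.
  At \<open>top\<close> there is no letter, hence the value 1.\<close>

definition b_sum :: "'a \<Rightarrow> ab_poly"
  where "b_sum X = (if X = top then 1 else var B * tail_sum max_label X)"

abbreviation D :: ab_poly
  where "D \<equiv> var A - var B"

lemma path_sum_top: "path_sum l e top = 1"
  by (simp add: path_sum_def)

lemma path_sum_step:
  assumes "X \<noteq> top"
  shows "path_sum l e X = (\<Sum>Z\<in>cov X. step_letter l (lam X Z) e False * path_sum (lam X Z) False Z +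
      scalar (monom 1 1) * (step_letter l (lam X Z) e True * path_sum (lam X Z) True Z))"
  unfolding path_sum_def sum_paths_step[OF assms] by (simp add: sum.distrib sum_distrib_left)

lemma b_sum_tail_sum: "X \<noteq> top \<Longrightarrow> b_sum X =
    (\<Sum>Z\<in>cov X. var B * (path_sum (lam X Z) False Z + scalar (monom 1 1) * path_sum (lam X Z) True Z))"
  by (simp add: b_sum_def tail_sum_def lam_less_max_label sum_distrib_left)

text \<open>Each letter is b or \<open>D\<close> plus b, and the parts with b form
  \<open>b_sum X\<close>. After a step outside \<open>E\<close> the letter is a exactly when the
  next step rises weakly and is outside \<open>E\<close>.\<close>

lemma path_sum_False_step:
  assumes "X \<noteq> top"
  shows "path_sum l False X = b_sum X + D * (\<Sum>Z\<in>{Z\<in>cov X. l \<le> lam X Z}. path_sum (lam X Z) False Z)"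
  unfolding path_sum_step[OF assms] b_sum_tail_sum[OF assms] sum.inter_filter[OF finite_cov] sum_distrib_left
    sum.distrib[symmetric]
  by (intro sum.cong) (auto simp: step_letter_def algebra_simps scalar_left_commute)

text \<open>After a step in \<open>E\<close> the letter is b only if the next step is in
  \<open>E\<close> and has label at least \<open>l\<close>; the choices that give a are those
  collected by \<open>tail_sum l\<close>.\<close>

lemma path_sum_True_step:
  assumes "X \<noteq> top"
  shows "path_sum l True X = b_sum X + D * tail_sum l X"
  unfolding path_sum_step[OF assms] b_sum_tail_sum[OF assms] tail_sum_def sum_distrib_left sum.distrib[symmetric]
  by (intro sum.cong) (auto simp: step_letter_def algebra_simps scalar_left_commute)

text \<open>Since \<open>f Z Y\<close> vanishes unless \<open>Z \<le> Y\<close>, the inner sum may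
  run over all \<open>Y\<close> above \<open>X\<close>; its range is then independent of
  \<open>Z\<close> and the sums can be swapped.\<close>

lemma sum_cov_spread:
  assumes "X \<in> P" "C \<subseteq> cov X" "\<And>Z Y. \<not> Z \<le> Y \<Longrightarrow> f Z Y = 0"
  shows "(\<Sum>Z\<in>C. \<Sum>Y\<in>P \<inter> {Z..}. scalar (f Z Y) * (D ^ (rk Y - rk Z) * b_sum Y)) =
    (\<Sum>Y\<in>P \<inter> {X<..}. scalar (\<Sum>Z\<in>C. f Z Y) * (D ^ (rk Y - Suc (rk X)) * b_sum Y))"
proof -
  have "(\<Sum>Y\<in>P \<inter> {Z..}. scalar (f Z Y) * (D ^ (rk Y - rk Z) * b_sum Y)) =
      (\<Sum>Y\<in>P \<inter> {X<..}. scalar (f Z Y) * (D ^ (rk Y - Suc (rk X)) * b_sum Y))" if "Z \<in> C" for Z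
  proof -
    have Z: "covers P X Z"
      using that assms(2) by (auto simp: cov_def)
    then have "P \<inter> {Z..} \<subseteq> P \<inter> {X<..}"
      by (auto simp: covers_def)
    then show ?thesis
      unfolding rk_covers[OF Z] using finite_P
      by (intro sum.mono_neutral_left) (auto simp: assms(3))
  qed
  then have "(\<Sum>Z\<in>C. \<Sum>Y\<in>P \<inter> {Z..}. scalar (f Z Y) * (D ^ (rk Y - rk Z) * b_sum Y)) =
      (\<Sum>Z\<in>C. \<Sum>Y\<in>P \<inter> {X<..}. scalar (f Z Y) * (D ^ (rk Y - Suc (rk X)) * b_sum Y))"
    by (rule sum.cong[OF refl])
  also have "\<dots> = (\<Sum>Y\<in>P \<inter> {X<..}. \<Sum>Z\<in>C. scalar (f Z Y) * (D ^ (rk Y - Suc (rk X)) * b_sum Y))"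
    by (rule sum.swap)
  finally show ?thesis
    by (simp only: scalar_sum sum_distrib_right)
qed

lemma sum_D_shift:
  assumes "X \<in> P"
  shows "D * (\<Sum>Y\<in>P \<inter> {X<..}. scalar (f Y) * (D ^ (rk Y - Suc (rk X)) * b_sum Y)) =
    (\<Sum>Y\<in>P \<inter> {X<..}. scalar (f Y) * (D ^ (rk Y - rk X) * b_sum Y))"
proof -
  have "D * (scalar p * (D ^ (rk Y - Suc (rk X)) * w)) = scalar p * (D ^ (rk Y - rk X) * w)"
    if "Y \<in> P \<inter> {X<..}" for Y p w
  proof -
    have "rk Y - rk X = Suc (rk Y - Suc (rk X))"
      using rk_less[of X Y] that assms by auto
    then show ?thesis
      by (simp only: scalar_left_commute power_Suc mult.assoc)
  qed
  then show ?thesis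
    unfolding sum_distrib_left by (intro sum.cong refl)
qed

lemma sum_above_split:
  assumes "X \<in> P"
  shows "(\<Sum>Y\<in>P \<inter> {X..}. f Y) = f X + (\<Sum>Y\<in>P \<inter> {X<..}. f Y)"
proof -
  have "P \<inter> {X..} = insert X (P \<inter> {X<..})"
    using assms by (auto simp: order.order_iff_strict)
  then show ?thesis
    using finite_P by simp
qed

text \<open>At each \<open>Y\<close> the steps outside \<open>E\<close> contribute 1, the number of
  increasing paths from \<open>X\<close> to \<open>Y\<close>, and the falling steps in
  \<open>E\<close> contribute the rest of \<open>fall_poly_step\<close>. The expansions above
  \<open>X\<close> are hypotheses so that the lemma can serve inside the induction that proves
  them.\<close>

lemma tail_sum_expand:
  assumes "X \<in> P"
    and inc: "\<And>Z l. Z \<in> P \<Longrightarrow> X < Z \<Longrightarrow>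
      path_sum l False Z = (\<Sum>Y\<in>P \<inter> {Z..}. scalar (of_int (inc l Z Y)) * (D ^ (rk Y - rk Z) * b_sum Y))"
    and fall_poly: "\<And>Z l. Z \<in> P \<Longrightarrow> X < Z \<Longrightarrow>
      path_sum l True Z = (\<Sum>Y\<in>P \<inter> {Z..}. scalar (fall_poly l Z Y) * (D ^ (rk Y - rk Z) * b_sum Y))"
  shows "tail_sum l X = (\<Sum>Y\<in>P \<inter> {X<..}. scalar (fall_poly l X Y) * (D ^ (rk Y - Suc (rk X)) * b_sum Y))"
proof -
  let ?f = "\<lambda>Z Y. of_int (inc (lam X Z) Z Y) +
    (if lam X Z < l then monom 1 1 * fall_poly (lam X Z) Z Y else 0)"
  have "tail_sum l X = (\<Sum>Z\<in>cov X. \<Sum>Y\<in>P \<inter> {Z..}. scalar (?f Z Y) * (D ^ (rk Y - rk Z) * b_sum Y))"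
    unfolding tail_sum_def
    by (intro sum.cong) (auto simp: inc fall_poly cov_def covers_def sum.distrib[symmetric]
        sum_distrib_left scalar_add scalar_mult distrib_right mult.assoc)
  also have "\<dots> = (\<Sum>Y\<in>P \<inter> {X<..}. scalar (\<Sum>Z\<in>cov X. ?f Z Y) * (D ^ (rk Y - Suc (rk X)) * b_sum Y))"
    using assms(1) by (intro sum_cov_spread) (auto simp: path_count_not_le fall_poly_not_le)
  also have "\<dots> = (\<Sum>Y\<in>P \<inter> {X<..}. scalar (fall_poly l X Y) * (D ^ (rk Y - Suc (rk X)) * b_sum Y))"
  proof (rule sum.cong)
    fix Y assume Y: "Y \<in> P \<inter> {X<..}"
    have "(\<Sum>Z\<in>cov X. inc (lam X Z) Z Y) = 1"
      using inc_0[of X Y] path_count_step[of X Y "(\<le>)" 0] Y assms(1) by auto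
    then have "(\<Sum>Z\<in>cov X. (of_int (inc (lam X Z) Z Y) :: int poly)) = 1"
      by (metis of_int_1 of_int_sum)
    then have "(\<Sum>Z\<in>cov X. ?f Z Y) = fall_poly l X Y"
      using Y assms(1) by (subst fall_poly_step[of X Y])
        (auto simp: sum.distrib sum_distrib_left sum.inter_filter[OF finite_cov] intro!: sum.cong)
    then show "scalar (\<Sum>Z\<in>cov X. ?f Z Y) * (D ^ (rk Y - Suc (rk X)) * b_sum Y) =
        scalar (fall_poly l X Y) * (D ^ (rk Y - Suc (rk X)) * b_sum Y)"
      by simp
  qed simp
  finally show ?thesis .
qed

text \<open>\<open>Y\<close> is the first place where b is chosen, or \<open>top\<close> if there is
  none; \<open>D\<close> is chosen at all ranks before. If the arriving step is outside
  \<open>E\<close>, the path must then rise to \<open>Y\<close> and avoid \<open>E\<close>; if it is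
  in \<open>E\<close>, the path may first fall with its steps in \<open>E\<close>. The second case
  leads into the first, so both are proved together.\<close>

lemma path_sum_expand:
  assumes "X \<in> P"
  shows "path_sum l False X = (\<Sum>Y\<in>P \<inter> {X..}. scalar (of_int (inc l X Y)) * (D ^ (rk Y - rk X) * b_sum Y))"
    and "path_sum l True X = (\<Sum>Y\<in>P \<inter> {X..}. scalar (fall_poly l X Y) * (D ^ (rk Y - rk X) * b_sum Y))"
  using assms
proof (induction X arbitrary: l rule: up_induct)
  case (step X)
  {
    case 1
    show ?case
    proof (cases "X = top")
      case True
      then have "P \<inter> {X<..} = {}"
        using top by (auto dest: leD)
      then show ?thesis
        using True step.hyps by (simp add: sum_above_split path_sum_top b_sum_def)
    next
      case False
      have "(\<Sum>Z\<in>{Z\<in>cov X. l \<le> lam X Z}. path_sum (lam X Z) False Z) =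
          (\<Sum>Z\<in>{Z\<in>cov X. l \<le> lam X Z}. \<Sum>Y\<in>P \<inter> {Z..}.
            scalar (of_int (inc (lam X Z) Z Y)) * (D ^ (rk Y - rk Z) * b_sum Y))"
        by (intro sum.cong) (auto simp: cov_def covers_def step.IH(1))
      also have "\<dots> = (\<Sum>Y\<in>P \<inter> {X<..}. scalar (\<Sum>Z\<in>{Z\<in>cov X. l \<le> lam X Z}.
          of_int (inc (lam X Z) Z Y)) * (D ^ (rk Y - Suc (rk X)) * b_sum Y))"
        using step.hyps by (intro sum_cov_spread) (auto simp: path_count_not_le)
      also have "\<dots> = (\<Sum>Y\<in>P \<inter> {X<..}. scalar (of_int (inc l X Y)) *
          (D ^ (rk Y - Suc (rk X)) * b_sum Y))"
        by (intro sum.cong) (auto simp: path_count_step[of X])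
      finally show ?thesis
        using step.hyps by (simp add: path_sum_False_step[OF False] sum_above_split sum_D_shift)
    qed
  next
    case 2
    show ?case
    proof (cases "X = top")
      case True
      then have "P \<inter> {X<..} = {}"
        using top by (auto dest: leD)
      then show ?thesis
        using True step.hyps by (simp add: sum_above_split path_sum_top b_sum_def fall_poly_refl)
    next
      case False
      have "tail_sum l X = (\<Sum>Y\<in>P \<inter> {X<..}. scalar (fall_poly l X Y) * (D ^ (rk Y - Suc (rk X)) * b_sum Y))"
        using step by (intro tail_sum_expand) auto
      then show ?thesis
        using step.hyps by (simp add: path_sum_True_step[OF False] sum_above_split sum_D_shift fall_poly_refl)
    qed
  }
qed

text \<open>With the bound \<open>max_label\<close> the coefficients in
  \<open>tail_sum_expand\<close> become Poincare polynomials.\<close>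

lemma b_sum_expand:
  assumes "X \<in> P" "X \<noteq> top"
  shows "b_sum X = var B *
    (\<Sum>Y\<in>P \<inter> {X<..}. scalar (Poin (P \<inter> {X..Y})) * (D ^ (rk Y - Suc (rk X)) * b_sum Y))"
proof -
  have "tail_sum max_label X = (\<Sum>Y\<in>P \<inter> {X<..}. scalar (fall_poly max_label X Y) * (D ^ (rk Y - Suc (rk X)) * b_sum Y))"
    using assms by (intro tail_sum_expand path_sum_expand) auto
  then show ?thesis
    using assms by (simp add: b_sum_def Poin_interval less_imp_le)
qed

end

section \<open>The sum over chains\<close>

definition strict_lists :: "'a::order set \<Rightarrow> 'a list set"
  where "strict_lists S = {xs. sorted_wrt (<) xs \<and> set xs \<subseteq> S}"

lemma finite_strict_lists: "finite S \<Longrightarrow> finite (strict_lists S)"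
  by (rule finite_subset[OF _ finite_subset_distinct])
    (auto simp: strict_lists_def strict_sorted_distinct)

text \<open>A nonempty chain consists of its least element \<open>Y\<close> and a chain above
  \<open>Y\<close>.\<close>

lemma sum_strict_lists:
  assumes "finite S"
  shows "(\<Sum>xs\<in>strict_lists S. f xs) =
    f [] + (\<Sum>Y\<in>S. \<Sum>ys\<in>strict_lists (S \<inter> {Y<..}). f (Y # ys))"
proof -
  have eq: "strict_lists S = insert [] (\<Union>Y\<in>S. (#) Y ` strict_lists (S \<inter> {Y<..}))"
  proof (rule set_eqI)
    fix xs
    show "xs \<in> strict_lists S \<longleftrightarrow>
        xs \<in> insert [] (\<Union>Y\<in>S. (#) Y ` strict_lists (S \<inter> {Y<..}))"
      by (cases xs) (auto simp: strict_lists_def)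
  qed
  have "finite (strict_lists (S \<inter> {Y<..}))" for Y
    using assms by (simp add: finite_strict_lists)
  then have "(\<Sum>xs\<in>(\<Union>Y\<in>S. (#) Y ` strict_lists (S \<inter> {Y<..})). f xs) =
      (\<Sum>Y\<in>S. \<Sum>ys\<in>strict_lists (S \<inter> {Y<..}). f (Y # ys))"
    using assms by (subst sum.UNION_disjoint) (auto simp: sum.reindex)
  moreover have "finite (\<Union>Y\<in>S. (#) Y ` strict_lists (S \<inter> {Y<..}))"
    using assms by (auto simp: finite_strict_lists)
  ultimately show ?thesis
    unfolding eq by (subst sum.insert) auto
qed

section \<open>Chain weights and the recursion for \<open>b_sum\<close>\<close>

context R_labeled_poset
begin

text \<open>The part of the weight of a chain from rank \<open>r\<close> on; \<open>r = 0\<close>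
  gives \<open>wt\<close>.\<close>

definition rank_word :: "nat \<Rightarrow> nat set \<Rightarrow> ab_poly"
  where "rank_word r S = prod_list (map (\<lambda>i. if i \<in> S then var B else D) [r..<n])"

lemma rank_word_skip:
  assumes "r \<le> s" "s \<le> n" "\<forall>x\<in>S. s \<le> x"
  shows "rank_word r S = D ^ (s - r) * rank_word s S"
proof -
  have "[r..<n] = [r..<s] @ [s..<n]"
    using upt_add_eq_append[of r s "n - s"] assms by simp
  moreover have "map (\<lambda>i. if i \<in> S then var B else D) [r..<s] = map (\<lambda>_. D) [r..<s]"
    using assms(3) by auto
  ultimately show ?thesis
    by (simp add: rank_word_def map_replicate_const)
qed

lemma rank_word_insert:
  assumes "r < n"
  shows "rank_word r (insert r S) = var B * rank_word (Suc r) S"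
  using assms unfolding rank_word_def
  by (simp add: upt_conv_Cons) (auto intro!: arg_cong[where f = "\<lambda>w. var B * prod_list w"])

lemma rank_word_empty: "r \<le> n \<Longrightarrow> rank_word r {} = D ^ (n - r)"
  using rank_word_skip[of r n "{}"] by (simp add: rank_word_def)

primrec chain_prod :: "'a \<Rightarrow> 'a list \<Rightarrow> int poly"
  where
    "chain_prod X [] = Poin (P \<inter> {X..top})"
  | "chain_prod X (Y # ys) = Poin (P \<inter> {X..Y}) * chain_prod Y ys"

lemma chain_Poin_eq:
  assumes "sorted_wrt (<) (X # ys)"
  shows "chain_Poin P (set (X # ys)) = chain_prod X ys"
proof -
  have "(\<Prod>i<Suc (length ys). Poin (P \<inter> {((X # ys) @ [top]) ! i..((X # ys) @ [top]) ! Suc i})) =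
      chain_prod X ys"
    by (induction ys arbitrary: X) (simp_all add: prod.lessThan_Suc_shift del: prod.lessThan_Suc)
  moreover have "card (set (X # ys)) = Suc (length ys)"
    using distinct_card[OF strict_sorted_distinct[OF assms]] by simp
  ultimately show ?thesis
    unfolding chain_Poin_def enum_chain_set[OF assms] top_def[symmetric] Let_def by presburger
qed

lemma rk_lt_n: "X \<in> P \<Longrightarrow> X \<noteq> top \<Longrightarrow> rk X < n"
  using rk_less[OF _ top(1)] less_top rk_top by auto

text \<open>Iterating \<open>b_sum_expand\<close>, the successive places of b form a chain that
  starts at \<open>X\<close>.\<close>

lemma b_sum_chains:
  assumes "X \<in> P - {top}"
  shows "b_sum X = (\<Sum>ys\<in>strict_lists ((P - {top}) \<inter> {X<..}).
    scalar (chain_prod X ys) * rank_word (rk X) (rk ` set (X # ys)))"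
proof -
  have "X \<in> P" "X \<noteq> top"
    using assms by auto
  then show ?thesis
  proof (induction X rule: up_induct)
    case (step X)
    let ?S = "(P - {top}) \<inter> {X<..}"
    have lt: "rk X < n"
      using rk_lt_n step by blast
    have above: "P \<inter> {X<..} = insert top ?S"
      using top less_top[of X] step by auto
    \<comment> \<open>The letter b at the rank of \<open>X\<close>, \<open>D\<close> at the ranks
      strictly between \<open>X\<close> and \<open>Y\<close>, then the word from \<open>Y\<close>
      on.\<close>
    have word_eq: "var B * (D ^ (rk Y - Suc (rk X)) * rank_word (rk Y) (rk ` set (Y # ys))) =
        rank_word (rk X) (rk ` set (X # Y # ys))"
      if "Y \<in> ?S" "ys \<in> strict_lists (?S \<inter> {Y<..})" for Y ys
    proof -
      have "Suc (rk X) \<le> rk Y"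
        using that rk_less[of X Y] step.hyps by auto
      moreover have "rk Y \<le> n"
        using that rk_lt_n[of Y] by auto
      moreover have "\<forall>x\<in>rk ` set (Y # ys). rk Y \<le> x"
        using that rk_less[of Y] by (fastforce simp: strict_lists_def)
      ultimately show ?thesis
        using lt by (simp only: list.set image_insert rank_word_insert[of "rk X"]
            rank_word_skip[of "Suc (rk X)" "rk Y"])
    qed
    have "b_sum X = var B * (\<Sum>Y\<in>insert top ?S. scalar (Poin (P \<inter> {X..Y})) *
        (D ^ (rk Y - Suc (rk X)) * b_sum Y))"
      using b_sum_expand step above by simp
    \<comment> \<open>The summand at \<open>top\<close> belongs to the chain that consists of
      \<open>X\<close> alone.\<close>
    also have "\<dots> = var B * (scalar (Poin (P \<inter> {X..top})) * D ^ (n - Suc (rk X))) +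
        (\<Sum>Y\<in>?S. var B * (scalar (Poin (P \<inter> {X..Y})) * (D ^ (rk Y - Suc (rk X)) * b_sum Y)))"
      using finite_P by (simp add: b_sum_def rk_top distrib_left sum_distrib_left)
    also have "var B * (scalar (Poin (P \<inter> {X..top})) * D ^ (n - Suc (rk X))) =
        scalar (chain_prod X []) * rank_word (rk X) (rk ` set [X])"
      using lt by (simp add: scalar_left_commute rank_word_insert rank_word_empty)
    also have "(\<Sum>Y\<in>?S. var B * (scalar (Poin (P \<inter> {X..Y})) * (D ^ (rk Y - Suc (rk X)) * b_sum Y))) =
        (\<Sum>Y\<in>?S. \<Sum>ys\<in>strict_lists (?S \<inter> {Y<..}).
          scalar (chain_prod X (Y # ys)) * rank_word (rk X) (rk ` set (X # Y # ys)))"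
    proof (rule sum.cong[OF refl])
      fix Y assume Y: "Y \<in> ?S"
      have "?S \<inter> {Y<..} = (P - {top}) \<inter> {Y<..}"
        using Y by auto
      then have FY: "b_sum Y = (\<Sum>ys\<in>strict_lists (?S \<inter> {Y<..}).
          scalar (chain_prod Y ys) * rank_word (rk Y) (rk ` set (Y # ys)))"
        using step.IH[of Y] Y by simp
      show "var B * (scalar (Poin (P \<inter> {X..Y})) * (D ^ (rk Y - Suc (rk X)) * b_sum Y)) =
          (\<Sum>ys\<in>strict_lists (?S \<inter> {Y<..}).
            scalar (chain_prod X (Y # ys)) * rank_word (rk X) (rk ` set (X # Y # ys)))"
        unfolding FY sum_distrib_left
      proof (rule sum.cong[OF refl])
        fix ys assume ys: "ys \<in> strict_lists (?S \<inter> {Y<..})"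
        have "b * (scalar p * (d * (scalar q * w))) = scalar (p * q) * (b * (d * w))"
          for p q :: "int poly" and b d w
          by (metis scalar_left_commute scalar_mult mult.assoc)
        then show "var B * (scalar (Poin (P \<inter> {X..Y})) * (D ^ (rk Y - Suc (rk X)) *
            (scalar (chain_prod Y ys) * rank_word (rk Y) (rk ` set (Y # ys))))) =
            scalar (chain_prod X (Y # ys)) * rank_word (rk X) (rk ` set (X # Y # ys))"
          unfolding word_eq[OF Y ys, symmetric] chain_prod.simps .
      qed
    qed
    finally show ?case
      using finite_P by (subst sum_strict_lists) auto
  qed
qed

lemma wt_eq: "wt P C = rank_word 0 (rk ` C)"
  unfolding wt_def rank_word_def top_def[symmetric] rk_top ..

text \<open>Chains are sorted by their least element \<open>Y\<close>. No Poincare factor belongs to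
  the interval below \<open>Y\<close>, so the ranks there contribute only \<open>D ^ rk Y\<close>;
  the empty chain provides the summand at \<open>top\<close>.\<close>

lemma ex_ab_index_eq: "ex_ab_index P = (\<Sum>Y\<in>P. D ^ rk Y * b_sum Y)"
proof -
  let ?S = "P - {top}"
  have fin: "finite ?S"
    using finite_P by simp
  have chains: "{C. pred_on.chain ?S (<) C} = set ` strict_lists ?S"
    unfolding chain_iff_strict_sorted[OF fin] by (auto simp: strict_lists_def)
  have inj: "inj_on set (strict_lists ?S)"
    by (auto simp: inj_on_def strict_lists_def intro: strict_sorted_list_unique)
  have "ex_ab_index P = (\<Sum>xs\<in>strict_lists ?S. scalar (chain_Poin P (set xs)) * wt P (set xs))"
    unfolding ex_ab_index_def top_def[symmetric] chains by (simp add: sum.reindex[OF inj])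
  also have "\<dots> = scalar (chain_Poin P (set [])) * wt P (set []) +
      (\<Sum>Y\<in>?S. \<Sum>ys\<in>strict_lists (?S \<inter> {Y<..}).
        scalar (chain_Poin P (set (Y # ys))) * wt P (set (Y # ys)))"
    by (rule sum_strict_lists[OF fin])
  also have "scalar (chain_Poin P (set [])) * wt P (set []) = D ^ rk top * b_sum top"
    by (simp add: chain_Poin_def wt_eq rank_word_empty rk_top b_sum_def)
  also have "(\<Sum>Y\<in>?S. \<Sum>ys\<in>strict_lists (?S \<inter> {Y<..}).
        scalar (chain_Poin P (set (Y # ys))) * wt P (set (Y # ys))) = (\<Sum>Y\<in>?S. D ^ rk Y * b_sum Y)"
  proof (rule sum.cong[OF refl])
    fix Y assume Y: "Y \<in> ?S"
    show "(\<Sum>ys\<in>strict_lists (?S \<inter> {Y<..}).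
        scalar (chain_Poin P (set (Y # ys))) * wt P (set (Y # ys))) = D ^ rk Y * b_sum Y"
      unfolding b_sum_chains[OF Y] sum_distrib_left
    proof (rule sum.cong[OF refl])
      fix ys assume ys: "ys \<in> strict_lists (?S \<inter> {Y<..})"
      then have "sorted_wrt (<) (Y # ys)"
        by (auto simp: strict_lists_def)
      then have "chain_Poin P (set (Y # ys)) = chain_prod Y ys"
        by (rule chain_Poin_eq)
      moreover have "\<forall>x\<in>rk ` set (Y # ys). rk Y \<le> x"
        using Y ys rk_less[of Y] by (fastforce simp: strict_lists_def)
      then have "wt P (set (Y # ys)) = D ^ rk Y * rank_word (rk Y) (rk ` set (Y # ys))"
        unfolding wt_eq using rank_word_skip[of 0 "rk Y"] rk_lt_n[of Y] Y by simp
      ultimately show "scalar (chain_Poin P (set (Y # ys))) * wt P (set (Y # ys)) =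
          D ^ rk Y * (scalar (chain_prod Y ys) * rank_word (rk Y) (rk ` set (Y # ys)))"
        by (simp only: scalar_left_commute)
    qed
  qed
  finally show ?thesis
    using finite_P top(1) by (simp add: sum.remove)
qed

lemma sum_maxchains:
  "(\<Sum>(M, E)\<in>{M. pred_on.maxchain P (<) M} \<times> Pow {1..n}.
    scalar (monom 1 (card E)) * u_word n lam M E) = path_sum 0 False bot"
proof -
  have "P \<inter> {bot..top} = P"
    using bot top by auto
  then have "{M. pred_on.maxchain P (<) M} = (\<lambda>zs. set (bot # zs)) ` paths bot top"
    using maxchain_paths[OF bot(1) top(1)] bot(2) top(1) by auto
  moreover have "inj_on (\<lambda>zs. set (bot # zs)) (paths bot top)"
  proof (rule inj_onI)
    fix zs ws
    assume "zs \<in> paths bot top" "ws \<in> paths bot top" "set (bot # zs) = set (bot # ws)"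
    then have "bot # zs = bot # ws"
      by (intro strict_sorted_list_unique paths_sorted) assumption+
    then show "zs = ws"
      by simp
  qed
  ultimately have "(\<Sum>(M, E)\<in>{M. pred_on.maxchain P (<) M} \<times> Pow {1..n}.
      scalar (monom 1 (card E)) * u_word n lam M E) =
      (\<Sum>zs\<in>paths bot top. \<Sum>E\<in>Pow {1..n}.
        scalar (monom 1 (card E)) * u_word n lam (set (bot # zs)) E)"
    by (simp only: sum.cartesian_product[symmetric] sum.reindex o_def)
  also have "\<dots> = path_sum 0 False bot"
    unfolding path_sum_def
  proof (rule sum.cong[OF refl])
    fix zs assume zs: "zs \<in> paths bot top"
    then have "length zs = n"
      using length_path_bot[OF top(1)] rk_top by simp
    then show "(\<Sum>E\<in>Pow {1..n}. scalar (monom 1 (card E)) * u_word n lam (set (bot # zs)) E) =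
        word_sum 0 False (labels lam bot zs)"
      by (rule sum_u_word[OF paths_sorted[OF zs]])
  qed
  finally show ?thesis .
qed

text \<open>Below the first b the coefficients are \<open>inc 0 bot Y\<close>, which is 1: this
  matches the missing Poincare factor below the least element of a chain.\<close>

lemma path_sum_bot: "path_sum 0 False bot = (\<Sum>Y\<in>P. D ^ rk Y * b_sum Y)"
proof -
  have "P \<inter> {bot..} = P"
    using bot by auto
  then show ?thesis
    unfolding path_sum_expand(1)[OF bot(1)]
    by (intro sum.cong) (auto simp: inc_0 bot rk_bot)
qed

end

theorem theorem2p7:
  fixes P :: "'a::order set" and lam :: "'a \<Rightarrow> 'a \<Rightarrow> nat" and n :: nat
  assumes "graded_poset P n"
    and "R_labeling P lam"
  shows "ex_ab_index P =
    (\<Sum>(M, E)\<in>{M. pred_on.maxchain P (<) M} \<times> Pow {1..n}.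
       scalar (monom 1 (card E)) * u_word n lam M E)"
proof -
  interpret R_labeled_poset P n lam
    using assms by unfold_locales
  \<comment> \<open>Both sides equal the sum of \<open>D ^ rk Y * b_sum Y\<close> over
    \<open>P\<close>.\<close>
  show ?thesis
    by (simp only: ex_ab_index_eq sum_maxchains path_sum_bot)
qed

end
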